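(* Let $f \colon \mathbb{R}^p \to \mathbb{R}$ be $C^1$ with $L$-Lipschitz gradient ($L>0$) and let $C \subset \mathbb{R}^p$ be non-empty and closed. Let $0 < \gamma < 1/L$, let $x_0 \in C$, and let $(x_k)_{k\in\mathbb{N}}$ be any sequence generated by the projected gradient algorithm $$x_{k+1} \in \mathrm{proj}_C\big(x_k - \gamma \nabla f(x_k)\big), \qquad k \in \mathbb{N}.$$ Then any accumulation point $\bar x$ of $(x_k)_{k \in \mathbb{N}}$ is Fréchet stationary for $f$ on $C$ and satisfies $$f(y) \ge f(\bar x) - \frac{1}{\gamma}\|y - \bar x\|^2 \quad \text{for all } y \in C,$$ $$\mathrm{proj}_C\big(\bar x - s\nabla f(\bar x)\big) = \{\bar x\} \quad \text{for all } 0 < s < \gamma.$$ Furthermore, if such an accumulation point exists, then $\mathrm{proj}_{T_C(x_k)}(-\nabla f(x_k)) \to 0$ as $k \to \infty$.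
   Context: $\langle\cdot,\cdot\rangle$ and $\|\cdot\|$ denote the Euclidean scalar product and norm on $\mathbb{R}^p$. Projection: for a non-empty closed set $S \subset \mathbb{R}^p$ and $x \in \mathbb{R}^p$, $\mathrm{proj}_S(x) = \arg\min_{z \in S}\|x - z\|$, a non-empty set (possibly with several elements). The convergence $\mathrm{proj}_{T_C(x_k)}(-\nabla f(x_k)) \to 0$ means that $z_k \to 0$ for any choice $z_k \in \mathrm{proj}_{T_C(x_k)}(-\nabla f(x_k))$. Tangent cone: for $x \in C$, $T_C(x)$ is the set of $w \in \mathbb{R}^p$ such that $\frac{y_j - x}{\tau_j} \to w$ for some sequence $(y_j)$ in $C$ and some sequence $(\tau_j)$ of positive reals decreasing to $0$; it is a closed cone. Regular normal cone: for $x \in C$, $\hat N_C(x)$ is the set of $v \in \mathbb{R}^p$ such that $\langle v, y-x\rangle \le o(\|y-x\|)$ for $y \in C$, i.e. $\limsup_{y \to x,\ y \in C,\ y \ne x} \frac{\langle v, y-x\rangle}{\|y-x\|} \le 0$ (a condition that is vacuously true if $x$ is isolated in $C$). A point $x \in C$ is called Fréchet stationary for $f$ on $C$ if $-\nabla f(x) \in \hat N_C(x)$. *)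

theory Defs
  imports "HOL-Analysis.Analysis"
begin

(* Meaningful only where f is differentiable; gradient_eq and GDERIV_gradient below
   identify it with the vector D of GDERIV. *)
definition gradient :: "('a::euclidean_space \<Rightarrow> real) \<Rightarrow> 'a \<Rightarrow> 'a" where
  "gradient f x = (THE D. GDERIV f x :> D)"

definition C1 :: "('a::euclidean_space \<Rightarrow> real) \<Rightarrow> bool" where
  "C1 f \<longleftrightarrow> (\<forall>x. f differentiable (at x)) \<and> continuous_on UNIV (gradient f)"

definition proj :: "'a::real_normed_vector set \<Rightarrow> 'a \<Rightarrow> 'a set" where
  "proj S x = {z. is_arg_min (\<lambda>u. norm (x - u)) (\<lambda>u. u \<in> S) z}"

definition tangent_cone :: "'a::real_normed_vector set \<Rightarrow> 'a \<Rightarrow> 'a set" where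
  "tangent_cone C x = {w. \<exists>(y :: nat \<Rightarrow> 'a) (\<tau> :: nat \<Rightarrow> real).
     (\<forall>j. y j \<in> C) \<and> (\<forall>j. 0 < \<tau> j) \<and> decseq \<tau> \<and> \<tau> \<longlonglongrightarrow> 0 \<and>
     (\<lambda>j. (y j - x) /\<^sub>R \<tau> j) \<longlonglongrightarrow> w}"

(* The filter "at x within C" excludes x itself and is trivial when x is isolated in C;
   the upper limit, taken in ereal, is then minus infinity and the condition holds vacuously. *)
definition regular_normal_cone :: "'a::real_inner set \<Rightarrow> 'a \<Rightarrow> 'a set" where
  "regular_normal_cone C x =
     {v. Limsup (at x within C) (\<lambda>y. ereal (inner v (y - x) / norm (y - x))) \<le> 0}"

definition frechet_stationary :: "('a::euclidean_space \<Rightarrow> real) \<Rightarrow> 'a set \<Rightarrow> 'a \<Rightarrow> bool" where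
  "frechet_stationary f C x \<longleftrightarrow> x \<in> C \<and> - gradient f x \<in> regular_normal_cone C x"

definition accumulation_point :: "(nat \<Rightarrow> 'a::topological_space) \<Rightarrow> 'a \<Rightarrow> bool" where
  "accumulation_point x a \<longleftrightarrow> (\<exists>r :: nat \<Rightarrow> nat. strict_mono r \<and> (x \<circ> r) \<longlonglongrightarrow> a)"

lemma gradient_eq:
  assumes "GDERIV f x :> D"
  shows "gradient f x = D"
  unfolding gradient_def
proof (rule the_equality)
  show "GDERIV f x :> D" by (fact assms)
next
  fix E assume "GDERIV f x :> E"
  then have "(\<lambda>h. inner h E) = (\<lambda>h. inner h D)"
    using assms unfolding gderiv_def by (rule has_derivative_unique)
  then show "E = D"
    by (metis vector_eq_ldot)
qed

lemma GDERIV_gradient: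
  assumes "f differentiable (at x)"
  shows "GDERIV f x :> gradient f x"
proof -
  from assms obtain f' where f': "(f has_derivative f') (at x)"
    unfolding differentiable_def by blast
  then interpret bounded_linear f'
    by (rule has_derivative_bounded_linear)
  have "f' = (\<lambda>h. inner h (adjoint f' 1))"
    using adjoint_works[OF linear_axioms, of _ 1] by (auto simp: inner_real_def)
  with f' have "GDERIV f x :> adjoint f' 1"
    unfolding gderiv_def by metis
  then show ?thesis
    using gradient_eq by metis
qed

end

theory Submission
  imports Defs
begin

text \<open>
  Expanding squares, a point \<open>z\<close> of \<open>C\<close> is a projection of \<open>x - \<gamma> g\<close> exactly when it minimises over
  \<open>C\<close> the model \<open>u \<mapsto> \<langle>g, u - x\<rangle> + \<parallel>u - x\<parallel>\<^sup>2 / (2 \<gamma>)\<close> (\<open>mem_proj_gradient_step_iff\<close>). Everything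
  follows from this description of a step together with the quadratic bound
  \<open>\<bar>f y - f x - \<langle>\<nabla>f x, y - x\<rangle>\<bar> \<le> L/2 \<parallel>y - x\<parallel>\<^sup>2\<close> for functions with Lipschitz gradient.

  Comparing the model at \<open>x\<^sub>k\<^sub>+\<^sub>1\<close> and \<open>x\<^sub>k\<close> shows that \<open>f\<close> decreases by at least a multiple of
  \<open>\<parallel>x\<^sub>k\<^sub>+\<^sub>1 - x\<^sub>k\<parallel>\<^sup>2\<close>; the multiple is positive because \<open>\<gamma> < 1/L\<close>. An accumulation point bounds the
  decreasing sequence \<open>f x\<^sub>k\<close> from below, hence the steps of the whole sequence tend to \<open>0\<close>
  (\<open>projected_gradient_steps_vanish\<close>). Along a subsequence converging to \<open>a\<close> the successors then
  converge to \<open>a\<close> as well, and the minimality of the model passes to the limit: \<open>a\<close> is itself a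
  projection of \<open>a - \<gamma> \<nabla>f a\<close>, that is,
  \<open>\<langle>\<nabla>f a, y - a\<rangle> + \<parallel>y - a\<parallel>\<^sup>2 / (2 \<gamma>) \<ge> 0\<close> on \<open>C\<close>. This one inequality yields the three claims
  about \<open>a\<close>: dividing by \<open>\<parallel>y - a\<parallel>\<close> gives stationarity, adding the lower quadratic bound gives the
  estimate on \<open>f\<close>, and decreasing the step length makes it strict off \<open>a\<close>.

  For the tangent cones, minimality of \<open>x\<^sub>k\<^sub>+\<^sub>1\<close> says that \<open>x\<^sub>k - \<gamma> \<nabla>f x\<^sub>k - x\<^sub>k\<^sub>+\<^sub>1\<close> is a normal at
  \<open>x\<^sub>k\<^sub>+\<^sub>1\<close>. Replacing \<open>\<nabla>f x\<^sub>k\<close> by \<open>\<nabla>f x\<^sub>k\<^sub>+\<^sub>1\<close> costs a multiple of the step, so \<open>-\<nabla>f x\<^sub>k\<^sub>+\<^sub>1\<close> has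
  scalar product at most \<open>const \<cdot> \<parallel>x\<^sub>k\<^sub>+\<^sub>1 - x\<^sub>k\<parallel> \<parallel>w\<parallel>\<close> with every tangent vector \<open>w\<close>, which bounds
  its projections on the tangent cone by a multiple of the step. The gradients themselves may be
  unbounded along the sequence; only their differences over one step matter, and these vanish along
  the whole sequence.
\<close>

section \<open>Quadratic bounds for Lipschitz gradients\<close>

text \<open>
  On the segment from \<open>x\<close> to \<open>y\<close>, the difference between \<open>f\<close> and the quadratic upper model has a
  nonpositive derivative, because the gradient moves by at most \<open>L t \<parallel>y - x\<parallel>\<close> up to time \<open>t\<close>.
\<close>

lemma Lipschitz_gradient_upper_bound:
  fixes f :: "'a::euclidean_space \<Rightarrow> real"
  assumes deriv: "\<And>x. GDERIV f x :> g x" and lip: "L-lipschitz_on UNIV g"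
  shows "f y \<le> f x + inner (g x) (y - x) + L / 2 * (norm (y - x))\<^sup>2"
proof -
  define h where "h = y - x"
  define \<phi> where "\<phi> t = f (x + t *\<^sub>R h) - t * inner (g x) h - L / 2 * t\<^sup>2 * (norm h)\<^sup>2" for t
  have "\<phi> 1 \<le> \<phi> 0"
  proof (rule DERIV_nonpos_imp_nonincreasing[where f = \<phi>])
    fix t :: real assume t: "0 \<le> t" "t \<le> 1"
    have "((\<lambda>t. f (x + t *\<^sub>R h)) has_derivative (\<lambda>s. inner (s *\<^sub>R h) (g (x + t *\<^sub>R h)))) (at t)"
    proof (rule has_derivative_compose[where g = f and f = "\<lambda>t. x + t *\<^sub>R h"])
      show "((\<lambda>t. x + t *\<^sub>R h) has_derivative (\<lambda>s. s *\<^sub>R h)) (at t)"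
        by (auto intro!: derivative_eq_intros)
      show "(f has_derivative (\<lambda>v. inner v (g (x + t *\<^sub>R h)))) (at (x + t *\<^sub>R h))"
        using deriv[of "x + t *\<^sub>R h"] by (simp add: gderiv_def)
    qed
    then have "((\<lambda>t. f (x + t *\<^sub>R h)) has_real_derivative inner (g (x + t *\<^sub>R h)) h) (at t)"
      by (simp add: has_field_derivative_def inner_commute mult_commute_abs)
    then have D: "(\<phi> has_real_derivative
        inner (g (x + t *\<^sub>R h)) h - inner (g x) h - L * t * (norm h)\<^sup>2) (at t)"
      unfolding \<phi>_def by (auto intro!: derivative_eq_intros)
    have "inner (g (x + t *\<^sub>R h)) h - inner (g x) h = inner (g (x + t *\<^sub>R h) - g x) h"
      by (simp add: inner_diff_left)
    also have "\<dots> \<le> norm (g (x + t *\<^sub>R h) - g x) * norm h"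
      by (rule norm_cauchy_schwarz)
    also have "\<dots> \<le> (L * (t * norm h)) * norm h"
      using lipschitz_onD[OF lip, of "x + t *\<^sub>R h" x] t
      by (intro mult_right_mono) (auto simp: dist_norm)
    finally have "inner (g (x + t *\<^sub>R h)) h - inner (g x) h - L * t * (norm h)\<^sup>2 \<le> 0"
      by (simp add: power2_eq_square algebra_simps)
    with D show "\<exists>l. (\<phi> has_real_derivative l) (at t) \<and> l \<le> 0"
      by blast
  qed simp
  then show ?thesis
    by (simp add: \<phi>_def h_def)
qed

lemma Lipschitz_gradient_lower_bound:
  fixes f :: "'a::euclidean_space \<Rightarrow> real"
  assumes deriv: "\<And>x. GDERIV f x :> g x" and lip: "L-lipschitz_on UNIV g"
  shows "f y \<ge> f x + inner (g x) (y - x) - L / 2 * (norm (y - x))\<^sup>2"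
proof -
  have "- f y \<le> - f x + inner (- g x) (y - x) + L / 2 * (norm (y - x))\<^sup>2"
  proof (rule Lipschitz_gradient_upper_bound)
    show "GDERIV (\<lambda>x. - f x) z :> - g z" for z
      by (rule GDERIV_minus) (rule deriv)
    show "L-lipschitz_on UNIV (\<lambda>x. - g x)"
      using lip by simp
  qed
  then show ?thesis
    by simp
qed

section \<open>Projections of gradient steps\<close>

text \<open>
  The squared distance from \<open>x - s g\<close> to \<open>u\<close> is \<open>2 s\<close> times the model value at \<open>u\<close> plus the
  constant \<open>\<parallel>s g\<parallel>\<^sup>2\<close>, so both have the same minimisers.
\<close>

lemma mem_proj_gradient_step_iff:
  fixes x g :: "'a::real_inner"
  assumes "s > 0"
  shows "z \<in> proj C (x - s *\<^sub>R g) \<longleftrightarrow>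
    z \<in> C \<and> (\<forall>y\<in>C. inner g (z - x) + (norm (z - x))\<^sup>2 / (2 * s)
                     \<le> inner g (y - x) + (norm (y - x))\<^sup>2 / (2 * s))"
proof -
  have model: "(norm (x - s *\<^sub>R g - u))\<^sup>2 =
      2 * s * (inner g (u - x) + (norm (u - x))\<^sup>2 / (2 * s)) + (norm (s *\<^sub>R g))\<^sup>2" for u
  proof -
    have "(norm (x - s *\<^sub>R g - u))\<^sup>2 =
        (norm (u - x))\<^sup>2 + 2 * s * inner g (u - x) + (norm (s *\<^sub>R g))\<^sup>2"
      by (simp add: power2_norm_eq_inner inner_diff_left inner_diff_right inner_commute
          right_diff_distrib del: norm_scaleR)
    then show ?thesis
      using assms by (simp add: distrib_left)
  qed
  have "norm (x - s *\<^sub>R g - z) \<le> norm (x - s *\<^sub>R g - y) \<longleftrightarrow>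
      inner g (z - x) + (norm (z - x))\<^sup>2 / (2 * s)
        \<le> inner g (y - x) + (norm (y - x))\<^sup>2 / (2 * s)" for y
  proof -
    have "norm (x - s *\<^sub>R g - z) \<le> norm (x - s *\<^sub>R g - y) \<longleftrightarrow>
        (norm (x - s *\<^sub>R g - z))\<^sup>2 \<le> (norm (x - s *\<^sub>R g - y))\<^sup>2"
      by (simp add: power2_le_iff_abs_le)
    then show ?thesis
      unfolding model using assms by simp
  qed
  then show ?thesis
    unfolding proj_def is_arg_min_def by (auto simp: not_less)
qed

text \<open>
  Strict positivity of the model off \<open>a\<close> comes from the gap \<open>1/(2 s) - 1/(2 \<gamma>) > 0\<close>.
\<close>

lemma proj_shorter_gradient_step:
  fixes a g :: "'a::real_inner"
  assumes fixpt: "a \<in> proj C (a - \<gamma> *\<^sub>R g)" and s: "0 < s" "s < \<gamma>"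
  shows "proj C (a - s *\<^sub>R g) = {a}"
proof -
  have a: "a \<in> C" and model: "\<And>y. y \<in> C \<Longrightarrow> 0 \<le> inner g (y - a) + (norm (y - a))\<^sup>2 / (2 * \<gamma>)"
    using fixpt s by (auto simp: mem_proj_gradient_step_iff)
  have strict: "0 < inner g (y - a) + (norm (y - a))\<^sup>2 / (2 * s)" if "y \<in> C" "y \<noteq> a" for y
  proof -
    have "(norm (y - a))\<^sup>2 / (2 * \<gamma>) < (norm (y - a))\<^sup>2 / (2 * s)"
      using s that by (intro divide_strict_left_mono) auto
    with model[OF \<open>y \<in> C\<close>] show ?thesis
      by linarith
  qed
  have "a \<in> proj C (a - s *\<^sub>R g)"
    using a strict s by (fastforce simp: mem_proj_gradient_step_iff)
  moreover have "z = a" if "z \<in> proj C (a - s *\<^sub>R g)" for z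
  proof (rule ccontr)
    assume "z \<noteq> a"
    with that a s strict[of z] show False
      by (auto simp: mem_proj_gradient_step_iff dest!: bspec[where x = a])
  qed
  ultimately show ?thesis
    by blast
qed

lemma proj_gradient_fixpoint_imp_regular_normal:
  fixes a g :: "'a::real_inner"
  assumes fixpt: "a \<in> proj C (a - \<gamma> *\<^sub>R g)" and "\<gamma> > 0"
  shows "- g \<in> regular_normal_cone C a"
proof -
  have model: "0 \<le> inner g (y - a) + (norm (y - a))\<^sup>2 / (2 * \<gamma>)" if "y \<in> C" for y
    using fixpt \<open>\<gamma> > 0\<close> that by (auto simp: mem_proj_gradient_step_iff)
  have bound: "inner (- g) (y - a) / norm (y - a) \<le> norm (y - a) / (2 * \<gamma>)"
    if "y \<in> C" "y \<noteq> a" for y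
  proof -
    have "inner (- g) (y - a) \<le> norm (y - a) / (2 * \<gamma>) * norm (y - a)"
      using model[OF \<open>y \<in> C\<close>] by (simp add: power2_eq_square)
    then show ?thesis
      using that by (subst pos_divide_le_eq) auto
  qed
  have lim: "((\<lambda>y. ereal (norm (y - a) / (2 * \<gamma>))) \<longlongrightarrow> ereal 0) (at a within C)"
    by (intro tendsto_intros tendsto_eq_intros) (use \<open>\<gamma> > 0\<close> in auto)
  have "Limsup (at a within C) (\<lambda>y. ereal (inner (- g) (y - a) / norm (y - a)))
      \<le> Limsup (at a within C) (\<lambda>y. ereal (norm (y - a) / (2 * \<gamma>)))"
    by (rule Limsup_mono) (auto simp: eventually_at_filter bound simp del: inner_minus_left)
  \<comment> \<open>If \<open>a\<close> is isolated in \<open>C\<close>, the filter is trivial and the upper limit is \<open>-\<infinity>\<close>.\<close>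
  also have "\<dots> \<le> 0"
  proof (cases "at a within C = bot")
    case False
    from lim_imp_Limsup[OF False lim] show ?thesis
      by simp
  qed simp
  finally show ?thesis
    by (simp add: regular_normal_cone_def)
qed

section \<open>Tangent cones\<close>

lemma zero_mem_tangent_cone:
  assumes "a \<in> C"
  shows "0 \<in> tangent_cone C a"
proof -
  have "decseq (\<lambda>j. inverse (real (Suc j)))"
    by (auto simp: decseq_def field_simps)
  with assms LIMSEQ_inverse_real_of_nat show ?thesis
    unfolding tangent_cone_def
    by (auto intro!: exI[of _ "\<lambda>_. a"] exI[of _ "\<lambda>j. inverse (real (Suc j))"])
qed

text \<open>
  A bound on \<open>\<langle>v, y - a\<rangle>\<close> that is quadratic in \<open>y - a\<close> vanishes after dividing by \<open>\<tau>\<close> and letting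
  \<open>(y - a) / \<tau>\<close> converge.
\<close>

lemma quadratic_normal_inner_tangent_le_0:
  fixes v :: "'a::real_inner"
  assumes normal: "\<And>y. y \<in> C \<Longrightarrow> inner v (y - a) \<le> c * (norm (y - a))\<^sup>2"
    and w: "w \<in> tangent_cone C a"
  shows "inner v w \<le> 0"
proof -
  obtain y \<tau> where y: "\<And>j. y j \<in> C" and \<tau>: "\<And>j. 0 < \<tau> j" "\<tau> \<longlonglongrightarrow> 0"
    and lim: "(\<lambda>j. (y j - a) /\<^sub>R \<tau> j) \<longlonglongrightarrow> w"
    using w unfolding tangent_cone_def by blast
  define q where "q j = (y j - a) /\<^sub>R \<tau> j" for j
  have "q \<longlonglongrightarrow> w"
    using lim by (simp add: q_def[abs_def])
  have "inner v (q j) \<le> c * \<tau> j * (norm (q j))\<^sup>2" for j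
  proof -
    have step: "y j - a = \<tau> j *\<^sub>R q j"
      using \<tau>(1)[of j] by (simp add: q_def)
    have "\<tau> j * inner v (q j) \<le> \<tau> j * (c * \<tau> j * (norm (q j))\<^sup>2)"
      using normal[OF y[of j]] unfolding step by (simp add: power2_eq_square mult_ac)
    then show ?thesis
      using \<tau>(1)[of j] by simp
  qed
  moreover have "(\<lambda>j. inner v (q j)) \<longlonglongrightarrow> inner v w"
    by (intro tendsto_intros) fact
  moreover have "(\<lambda>j. c * \<tau> j * (norm (q j))\<^sup>2) \<longlonglongrightarrow> c * 0 * (norm w)\<^sup>2"
    by (intro tendsto_intros) fact+
  ultimately show ?thesis
    using LIMSEQ_le[of "\<lambda>j. inner v (q j)"] by fastforce
qed

text \<open>
  Comparing \<open>z\<close> with the competitor \<open>0\<close> gives \<open>\<parallel>z\<parallel>\<^sup>2 \<le> 2 \<langle>v, z\<rangle>\<close>; the bound on \<open>\<langle>v, z\<rangle>\<close> is linear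
  in \<open>\<parallel>z\<parallel>\<close>, so one factor cancels.
\<close>

lemma norm_proj_le_of_inner_le:
  fixes v :: "'a::real_inner"
  assumes z: "z \<in> proj T v" and "0 \<in> T" and bound: "\<And>w. w \<in> T \<Longrightarrow> inner v w \<le> c * norm w"
    and "c \<ge> 0"
  shows "norm z \<le> 2 * c"
proof (cases "z = 0")
  case True
  with \<open>c \<ge> 0\<close> show ?thesis by simp
next
  case False
  have "z \<in> T" and "norm (v - z) \<le> norm (v - 0)"
    using z \<open>0 \<in> T\<close> unfolding proj_def is_arg_min_def by (auto simp: not_less)
  then have "(norm (v - z))\<^sup>2 \<le> (norm v)\<^sup>2"
    by (intro power_mono) auto
  then have "norm z * norm z \<le> 2 * inner v z"
    by (simp add: power2_norm_eq_inner inner_diff_left inner_diff_right inner_commute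
        flip: power2_eq_square)
  also have "\<dots> \<le> (2 * c) * norm z"
    using bound[OF \<open>z \<in> T\<close>] by simp
  finally show ?thesis
    using False by simp
qed

section \<open>Projected gradient steps\<close>

lemma projected_gradient_descent:
  fixes f :: "'a::euclidean_space \<Rightarrow> real"
  assumes deriv: "\<And>x. GDERIV f x :> g x" and lip: "L-lipschitz_on UNIV g"
    and "\<gamma> > 0" and "x \<in> C" and step: "x' \<in> proj C (x - \<gamma> *\<^sub>R g x)"
  shows "f x' \<le> f x - (1 / (2 * \<gamma>) - L / 2) * (norm (x' - x))\<^sup>2"
proof -
  have "inner (g x) (x' - x) + (norm (x' - x))\<^sup>2 / (2 * \<gamma>) \<le> 0"
    using step \<open>x \<in> C\<close> \<open>\<gamma> > 0\<close> by (force simp: mem_proj_gradient_step_iff)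
  with Lipschitz_gradient_upper_bound[OF deriv lip, of x' x] show ?thesis
    by (simp add: algebra_simps)
qed

text \<open>
  A decreasing sequence with a subsequence converging to \<open>f a\<close> is bounded below by \<open>f a\<close>; it
  therefore converges, its increments vanish, and the descent estimate turns this into vanishing
  steps.
\<close>

lemma projected_gradient_steps_vanish:
  fixes f :: "'a::euclidean_space \<Rightarrow> real"
  assumes deriv: "\<And>x. GDERIV f x :> g x" and lip: "L-lipschitz_on UNIV g"
    and \<gamma>: "\<gamma> > 0" "L < 1 / \<gamma>" and C: "\<And>k. x k \<in> C"
    and step: "\<And>k. x (Suc k) \<in> proj C (x k - \<gamma> *\<^sub>R g (x k))"
    and acc: "accumulation_point x a"
  shows "(\<lambda>k. norm (x (Suc k) - x k)) \<longlonglongrightarrow> 0"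
proof -
  define c where "c = 1 / (2 * \<gamma>) - L / 2"
  have "c = (1 / \<gamma> - L) / 2"
    by (simp add: c_def field_simps)
  with \<gamma> have "c > 0"
    by simp
  have descent: "c * (norm (x (Suc k) - x k))\<^sup>2 \<le> f (x k) - f (x (Suc k))" for k
    using projected_gradient_descent[OF deriv lip \<gamma>(1) C step, of k] by (simp add: c_def)
  have dec: "decseq (\<lambda>k. f (x k))"
  proof (rule decseq_SucI)
    fix k
    have "0 \<le> c * (norm (x (Suc k) - x k))\<^sup>2"
      using \<open>c > 0\<close> by simp
    with descent[of k] show "f (x (Suc k)) \<le> f (x k)"
      by linarith
  qed
  obtain r where r: "strict_mono r" "(x \<circ> r) \<longlonglongrightarrow> a"
    using acc unfolding accumulation_point_def by blast
  have "isCont f a"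
    using deriv[of a] by (auto simp: gderiv_def dest: has_derivative_continuous)
  then have lim: "(\<lambda>n. f (x (r n))) \<longlonglongrightarrow> f a"
    using r(2) by (auto intro: isCont_tendsto_compose simp: o_def)
  have "decseq (\<lambda>n. f (x (r n)))"
    using dec r(1) by (auto simp: decseq_def strict_mono_less_eq)
  then have "f a \<le> f (x (r n))" for n
    using lim by (rule decseq_ge)
  moreover have "f (x (r n)) \<le> f (x n)" for n
    using dec seq_suble[OF r(1), of n] by (auto simp: decseq_def)
  ultimately have "f a \<le> f (x n)" for n
    using order_trans by blast
  then obtain l where l: "(\<lambda>k. f (x k)) \<longlonglongrightarrow> l"
    using decseq_convergent[OF dec, of "f a"] by blast
  have "(\<lambda>k. (f (x k) - f (x (Suc k))) / c) \<longlonglongrightarrow> (l - l) / c"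
    using l LIMSEQ_Suc[OF l] \<open>c > 0\<close> by (intro tendsto_intros) auto
  then have decrease: "(\<lambda>k. (f (x k) - f (x (Suc k))) / c) \<longlonglongrightarrow> 0"
    by simp
  have "(norm (x (Suc k) - x k))\<^sup>2 \<le> (f (x k) - f (x (Suc k))) / c" for k
    using descent[of k] \<open>c > 0\<close> by (simp add: pos_le_divide_eq mult.commute)
  then have "(\<lambda>k. (norm (x (Suc k) - x k))\<^sup>2) \<longlonglongrightarrow> 0"
    by (intro Lim_null_comparison[OF _ decrease] always_eventually allI) simp
  from tendsto_real_sqrt[OF this] show ?thesis
    by simp
qed

text \<open>
  Since successive iterates share their limits, the inequalities expressing that \<open>x\<^sub>k\<^sub>+\<^sub>1\<close> minimises
  the model around \<open>x\<^sub>k\<close> converge to those expressing that \<open>a\<close> minimises the model around \<open>a\<close>.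
\<close>

lemma accumulation_point_proj_gradient_fixpoint:
  fixes g :: "'a::real_inner \<Rightarrow> 'a"
  assumes cont: "isCont g a" and "closed C" and "\<gamma> > 0"
    and C: "\<And>k. x k \<in> C"
    and step: "\<And>k. x (Suc k) \<in> proj C (x k - \<gamma> *\<^sub>R g (x k))"
    and vanish: "(\<lambda>k. norm (x (Suc k) - x k)) \<longlonglongrightarrow> 0"
    and acc: "accumulation_point x a"
  shows "a \<in> proj C (a - \<gamma> *\<^sub>R g a)"
proof -
  obtain r where r: "strict_mono r" "(x \<circ> r) \<longlonglongrightarrow> a"
    using acc unfolding accumulation_point_def by blast
  have lim: "(\<lambda>n. x (r n)) \<longlonglongrightarrow> a"
    using r(2) by (simp add: o_def)
  have limg: "(\<lambda>n. g (x (r n))) \<longlonglongrightarrow> g a"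
    using cont lim by (rule isCont_tendsto_compose)
  have limd: "(\<lambda>n. x (Suc (r n)) - x (r n)) \<longlonglongrightarrow> 0"
    using LIMSEQ_subseq_LIMSEQ[OF tendsto_norm_zero_cancel[OF vanish] r(1)] by (simp add: o_def)
  have "a \<in> C"
    using closed_sequentially[OF \<open>closed C\<close> _ lim] C by blast
  moreover have "inner (g a) 0 + (norm (0::'a))\<^sup>2 / (2 * \<gamma>)
      \<le> inner (g a) (y - a) + (norm (y - a))\<^sup>2 / (2 * \<gamma>)" if "y \<in> C" for y
  proof (rule LIMSEQ_le)
    show "(\<lambda>n. inner (g (x (r n))) (x (Suc (r n)) - x (r n))
          + (norm (x (Suc (r n)) - x (r n)))\<^sup>2 / (2 * \<gamma>))
        \<longlonglongrightarrow> inner (g a) 0 + (norm (0::'a))\<^sup>2 / (2 * \<gamma>)"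
      by (intro tendsto_intros limg limd) (use \<open>\<gamma> > 0\<close> in simp)
    show "(\<lambda>n. inner (g (x (r n))) (y - x (r n)) + (norm (y - x (r n)))\<^sup>2 / (2 * \<gamma>))
        \<longlonglongrightarrow> inner (g a) (y - a) + (norm (y - a))\<^sup>2 / (2 * \<gamma>)"
      by (intro tendsto_intros limg lim) (use \<open>\<gamma> > 0\<close> in simp)
    show "\<exists>N. \<forall>n\<ge>N. inner (g (x (r n))) (x (Suc (r n)) - x (r n))
          + (norm (x (Suc (r n)) - x (r n)))\<^sup>2 / (2 * \<gamma>)
        \<le> inner (g (x (r n))) (y - x (r n)) + (norm (y - x (r n)))\<^sup>2 / (2 * \<gamma>)"
      using step that \<open>\<gamma> > 0\<close> by (auto simp: mem_proj_gradient_step_iff)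
  qed
  ultimately show ?thesis
    using \<open>\<gamma> > 0\<close> by (auto simp: mem_proj_gradient_step_iff)
qed

text \<open>
  The scaled residual \<open>(x - x') / \<gamma> - g x\<close> is a normal to \<open>C\<close> at \<open>x'\<close>, and it differs from \<open>-g x'\<close>
  by at most \<open>(1/\<gamma> + L) \<parallel>x' - x\<parallel>\<close>.
\<close>

lemma norm_proj_tangent_cone_after_step:
  fixes g :: "'a::real_inner \<Rightarrow> 'a"
  assumes lip: "L-lipschitz_on UNIV g" and "\<gamma> > 0"
    and step: "x' \<in> proj C (x - \<gamma> *\<^sub>R g x)"
    and z: "z \<in> proj (tangent_cone C x') (- g x')"
  shows "norm z \<le> 2 * ((1 / \<gamma> + L) * norm (x' - x))"
proof (rule norm_proj_le_of_inner_le[OF z])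
  have x': "x' \<in> C"
    using step \<open>\<gamma> > 0\<close> by (simp add: mem_proj_gradient_step_iff)
  then show "0 \<in> tangent_cone C x'"
    by (rule zero_mem_tangent_cone)
  have "L \<ge> 0"
    using lip by (rule lipschitz_on_nonneg)
  then show "0 \<le> (1 / \<gamma> + L) * norm (x' - x)"
    using \<open>\<gamma> > 0\<close> by simp
  fix w assume w: "w \<in> tangent_cone C x'"
  define v where "v = (x - x') /\<^sub>R \<gamma> - g x"
  have "inner v (y - x') \<le> 1 / (2 * \<gamma>) * (norm (y - x'))\<^sup>2" if "y \<in> C" for y
  proof -
    have "inner (g x) (x' - x) + (norm (x' - x))\<^sup>2 / (2 * \<gamma>)
        \<le> inner (g x) (y - x) + (norm (y - x))\<^sup>2 / (2 * \<gamma>)"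
      using step that \<open>\<gamma> > 0\<close> by (simp add: mem_proj_gradient_step_iff)
    moreover have "(norm (y - x))\<^sup>2 / (2 * \<gamma>) =
        (norm (y - x'))\<^sup>2 / (2 * \<gamma>) + inner (y - x') (x' - x) / \<gamma>
          + (norm (x' - x))\<^sup>2 / (2 * \<gamma>)"
    proof -
      have "(norm (y - x))\<^sup>2 = (norm (y - x'))\<^sup>2 + 2 * inner (y - x') (x' - x)
          + (norm (x' - x))\<^sup>2"
        by (simp add: power2_norm_eq_inner inner_diff_left inner_diff_right inner_commute)
      then show ?thesis
        using \<open>\<gamma> > 0\<close> by (simp add: field_simps)
    qed
    moreover have "inner v (y - x') =
        - inner (y - x') (x' - x) / \<gamma> - inner (g x) (y - x) + inner (g x) (x' - x)"
    proof -
      have "inner v (y - x') = - inner (y - x') (x' - x) / \<gamma> - inner (g x) (y - x')"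
        by (simp add: v_def inner_diff_left[of "_ /\<^sub>R _"] inner_commute[of "y - x'"]
            divide_inverse mult.commute flip: inner_minus_left)
      moreover have "inner (g x) (y - x') = inner (g x) (y - x) - inner (g x) (x' - x)"
        by (simp flip: inner_diff_right)
      ultimately show ?thesis
        by simp
    qed
    ultimately show ?thesis
      by simp
  qed
  then have "inner v w \<le> 0"
    using w by (rule quadratic_normal_inner_tangent_le_0)
  define e where "e = (x' - x) /\<^sub>R \<gamma> + (g x - g x')"
  have "norm e \<le> norm ((x' - x) /\<^sub>R \<gamma>) + norm (g x - g x')"
    unfolding e_def by (rule norm_triangle_ineq)
  also have "norm ((x' - x) /\<^sub>R \<gamma>) = 1 / \<gamma> * norm (x' - x)"
    using \<open>\<gamma> > 0\<close> by (simp add: divide_inverse)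
  also have "1 / \<gamma> * norm (x' - x) + norm (g x - g x') \<le> (1 / \<gamma> + L) * norm (x' - x)"
    using lipschitz_onD[OF lip, of x x']
    by (simp add: dist_norm norm_minus_commute distrib_right)
  finally have e: "norm e \<le> (1 / \<gamma> + L) * norm (x' - x)" .
  have "- g x' = v + e"
    by (simp add: v_def e_def algebra_simps)
  then have "inner (- g x') w = inner v w + inner e w"
    by (simp add: inner_add_left)
  also have "\<dots> \<le> norm e * norm w"
    using \<open>inner v w \<le> 0\<close> norm_cauchy_schwarz[of e w] by linarith
  also have "\<dots> \<le> (1 / \<gamma> + L) * norm (x' - x) * norm w"
    using e by (rule mult_right_mono) simp
  finally show "inner (- g x') w \<le> (1 / \<gamma> + L) * norm (x' - x) * norm w" .
qed

section \<open>Accumulation points of the projected gradient algorithm\<close>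

theorem theorem2:
  fixes f :: "real ^ 'p \<Rightarrow> real" and C :: "(real ^ 'p) set"
    and L \<gamma> :: real and x :: "nat \<Rightarrow> real ^ 'p"
  assumes "C1 f"
    and "L > 0" and "L-lipschitz_on UNIV (gradient f)"
    and "C \<noteq> {}" and "closed C"
    and "0 < \<gamma>" and "\<gamma> < 1 / L"
    and "x 0 \<in> C"
    and "\<And>k. x (Suc k) \<in> proj C (x k - \<gamma> *\<^sub>R gradient f (x k))"
  shows "(\<forall>xbar. accumulation_point x xbar \<longrightarrow>
            frechet_stationary f C xbar \<and>
            (\<forall>y\<in>C. f y \<ge> f xbar - (1 / \<gamma>) * (norm (y - xbar))\<^sup>2) \<and>
            (\<forall>s. 0 < s \<and> s < \<gamma> \<longrightarrow> proj C (xbar - s *\<^sub>R gradient f xbar) = {xbar})) \<and>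
         ((\<exists>xbar. accumulation_point x xbar) \<longrightarrow>
            (\<forall>z. (\<forall>k. z k \<in> proj (tangent_cone C (x k)) (- gradient f (x k))) \<longrightarrow>
                 z \<longlonglongrightarrow> 0))"
proof -
  note lip = assms(3) and step = assms(9)
  have deriv: "GDERIV f u :> gradient f u" for u
    using \<open>C1 f\<close> by (intro GDERIV_gradient) (simp add: C1_def)
  have cont: "isCont (gradient f) u" for u
    using \<open>C1 f\<close> by (simp add: C1_def continuous_on_eq_continuous_at)
  have C: "x k \<in> C" for k
  proof (cases k)
    case (Suc n)
    with step[of n] \<open>0 < \<gamma>\<close> show ?thesis
      by (simp add: mem_proj_gradient_step_iff)
  qed (simp add: \<open>x 0 \<in> C\<close>)
  have L: "L < 1 / \<gamma>"
    using \<open>L > 0\<close> \<open>0 < \<gamma>\<close> \<open>\<gamma> < 1 / L\<close> by (simp add: field_simps)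
  have vanish: "(\<lambda>k. norm (x (Suc k) - x k)) \<longlonglongrightarrow> 0" if "accumulation_point x a" for a
    using projected_gradient_steps_vanish[OF deriv lip \<open>0 < \<gamma>\<close> L C step that] .
  have fixpt: "a \<in> proj C (a - \<gamma> *\<^sub>R gradient f a)" if "accumulation_point x a" for a
    using accumulation_point_proj_gradient_fixpoint
      [OF cont \<open>closed C\<close> \<open>0 < \<gamma>\<close> C step vanish[OF that] that] .
  show ?thesis
  proof (intro conjI allI impI ballI)
    fix a assume acc: "accumulation_point x a"
    show "frechet_stationary f C a"
      using proj_gradient_fixpoint_imp_regular_normal[OF fixpt[OF acc] \<open>0 < \<gamma>\<close>]
        fixpt[OF acc] \<open>0 < \<gamma>\<close>
      by (simp add: frechet_stationary_def mem_proj_gradient_step_iff)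
    show "proj C (a - s *\<^sub>R gradient f a) = {a}" if "0 < s \<and> s < \<gamma>" for s
      using proj_shorter_gradient_step[OF fixpt[OF acc]] that by blast
    fix y assume "y \<in> C"
    then have "0 \<le> inner (gradient f a) (y - a) + (norm (y - a))\<^sup>2 / (2 * \<gamma>)"
      using fixpt[OF acc] \<open>0 < \<gamma>\<close> by (auto simp: mem_proj_gradient_step_iff)
    moreover have "L / 2 * (norm (y - a))\<^sup>2 \<le> (1 / \<gamma>) / 2 * (norm (y - a))\<^sup>2"
      using L by (intro mult_right_mono) auto
    ultimately show "f y \<ge> f a - (1 / \<gamma>) * (norm (y - a))\<^sup>2"
      using Lipschitz_gradient_lower_bound[OF deriv lip, of a y] by (simp add: field_simps)
  next
    fix z assume "\<exists>a. accumulation_point x a"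
      and z: "\<forall>k. z k \<in> proj (tangent_cone C (x k)) (- gradient f (x k))"
    then have bound_vanish: "(\<lambda>k. 2 * ((1 / \<gamma> + L) * norm (x (Suc k) - x k))) \<longlonglongrightarrow> 0"
      using vanish by (auto intro!: tendsto_mult_right_zero)
    have "norm (z (Suc k)) \<le> 2 * ((1 / \<gamma> + L) * norm (x (Suc k) - x k))" for k
      using norm_proj_tangent_cone_after_step[OF lip \<open>0 < \<gamma>\<close> step] z by blast
    then have "(\<lambda>k. z (Suc k)) \<longlonglongrightarrow> 0"
      by (intro Lim_null_comparison[OF _ bound_vanish] always_eventually allI)
    then show "z \<longlonglongrightarrow> 0"
      by (rule LIMSEQ_imp_Suc)
  qed
qed

end
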